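(* Let $(\mathbb{C},\otimes,I)$ be a symmetric monoidal category with left unitor $\lambda$, whose tensor unit $I$ is a separator of $\mathbb{C}$, and such that for all objects $X,Y$ and any morphism $\overline{z}\colon I\to X\otimes Y$ there are $\overline{x}\colon I\to X$ and $\overline{y}\colon I\to Y$ satisfying $\overline{z}=(\overline{x}\otimes\overline{y})\circ\lambda_I^{-1}$. If $T$ is a strong monad with respect to $(\mathbb{C},\otimes,I)$, then its tensorial strength $\mathrm{st}^T\colon(-)\otimes T(=)\Rightarrow T(-\otimes=)$ is determined uniquely by $$\mathrm{st}^T_{X,Y}\circ(\overline{x}\otimes\overline{\xi})\circ\lambda_I^{-1}=T\bigl((\overline{x}\otimes Y)\circ\lambda_Y^{-1}\bigr)\circ\overline{\xi}$$ for all objects $X,Y$ and all morphisms $\overline{x}\colon I\to X$ and $\overline{\xi}\colon I\to TY$.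
   Context: An object $I$ of a category $\mathbb{C}$ is a separator if for any pair of arrows $f,g\colon X\to Y$ in $\mathbb{C}$, $f=g$ holds whenever $f\circ e=g\circ e$ for each $e\colon I\to X$. The left unitor has components $\lambda_X\colon I\otimes X\cong X$. The object $Y$ also denotes its identity morphism, so $\overline{x}\otimes Y=\overline{x}\otimes\mathrm{id}_Y$. A strong monad with respect to $(\mathbb{C},\otimes,I)$ is a monad $(T,\eta,\mu)$ on $\mathbb{C}$ equipped with a tensorial strength, i.e. a natural transformation $\mathrm{st}^T_{X,Y}\colon X\otimes TY\to T(X\otimes Y)$ satisfying the usual coherence conditions with the left unitor ($T(\lambda_Y)\circ\mathrm{st}^T_{I,Y}=\lambda_{TY}$), the associator, $\eta$ and $\mu$. *)

theory Defs
  imports Main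
begin

section \<open>Categories\<close>

record ('o, 'a) category =
  Obj :: "'o set"
  Arr :: "'a set"
  Dom :: "'a \<Rightarrow> 'o"
  Cod :: "'a \<Rightarrow> 'o"
  ide :: "'o \<Rightarrow> 'a" (\<open>id\<index> _\<close> [81] 80)
  Comp :: "'a \<Rightarrow> 'a \<Rightarrow> 'a" (infixr \<open>\<cdot>\<index>\<close> 55)

definition hom :: "('o, 'a, 'm) category_scheme \<Rightarrow> 'o \<Rightarrow> 'o \<Rightarrow> 'a set" where
  "hom C X Y = {f \<in> Arr C. Dom C f = X \<and> Cod C f = Y}"

locale category =
  fixes C (structure)
  assumes Dom_Obj: "f \<in> Arr C \<Longrightarrow> Dom C f \<in> Obj C"
    and Cod_Obj: "f \<in> Arr C \<Longrightarrow> Cod C f \<in> Obj C"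
    and ide_hom: "X \<in> Obj C \<Longrightarrow> id X \<in> hom C X X"
    and Comp_hom: "\<lbrakk>f \<in> hom C X Y; g \<in> hom C Y Z\<rbrakk> \<Longrightarrow> g \<cdot> f \<in> hom C X Z"
    and Comp_ide: "f \<in> hom C X Y \<Longrightarrow> f \<cdot> id X = f"
    and ide_Comp: "f \<in> hom C X Y \<Longrightarrow> id Y \<cdot> f = f"
    and Comp_assoc:
      "\<lbrakk>f \<in> hom C W X; g \<in> hom C X Y; h \<in> hom C Y Z\<rbrakk> \<Longrightarrow> (h \<cdot> g) \<cdot> f = h \<cdot> (g \<cdot> f)"

definition inverse_arrows :: "('o, 'a, 'm) category_scheme \<Rightarrow> 'a \<Rightarrow> 'a \<Rightarrow> bool" where
  "inverse_arrows C f g \<longleftrightarrow>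
     f \<in> Arr C \<and> g \<in> hom C (Cod C f) (Dom C f) \<and>
     g \<cdot>\<^bsub>C\<^esub> f = id\<^bsub>C\<^esub> (Dom C f) \<and> f \<cdot>\<^bsub>C\<^esub> g = id\<^bsub>C\<^esub> (Cod C f)"

definition iso_arrow :: "('o, 'a, 'm) category_scheme \<Rightarrow> 'a \<Rightarrow> bool" where
  "iso_arrow C f \<longleftrightarrow> (\<exists>g. inverse_arrows C f g)"

definition inv_arrow :: "('o, 'a, 'm) category_scheme \<Rightarrow> 'a \<Rightarrow> 'a" where
  "inv_arrow C f = (THE g. inverse_arrows C f g)"

definition separator :: "('o, 'a, 'm) category_scheme \<Rightarrow> 'o \<Rightarrow> bool" where
  "separator C S \<longleftrightarrow> S \<in> Obj C \<and>
     (\<forall>X\<in>Obj C. \<forall>Y\<in>Obj C. \<forall>f\<in>hom C X Y. \<forall>g\<in>hom C X Y.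
        (\<forall>e\<in>hom C S X. f \<cdot>\<^bsub>C\<^esub> e = g \<cdot>\<^bsub>C\<^esub> e) \<longrightarrow> f = g)"

definition prod_cat ::
  "('o, 'a, 'm) category_scheme \<Rightarrow> ('p, 'b, 'n) category_scheme \<Rightarrow> ('o \<times> 'p, 'a \<times> 'b) category"
  where
  "prod_cat C D =
     \<lparr>Obj = Obj C \<times> Obj D,
      Arr = Arr C \<times> Arr D,
      Dom = (\<lambda>(f, g). (Dom C f, Dom D g)),
      Cod = (\<lambda>(f, g). (Cod C f, Cod D g)),
      ide = (\<lambda>(X, Y). (id\<^bsub>C\<^esub> X, id\<^bsub>D\<^esub> Y)),
      Comp = (\<lambda>(g, g') (f, f'). (g \<cdot>\<^bsub>C\<^esub> f, g' \<cdot>\<^bsub>D\<^esub> f'))\<rparr>"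

section \<open>Functors and natural transformations\<close>

record ('o, 'a, 'p, 'b) functor_maps =
  omap :: "'o \<Rightarrow> 'p"
  amap :: "'a \<Rightarrow> 'b"

definition is_functor ::
  "('o, 'a, 'm) category_scheme \<Rightarrow> ('p, 'b, 'n) category_scheme \<Rightarrow>
   ('o, 'a, 'p, 'b) functor_maps \<Rightarrow> bool" where
  "is_functor C D F \<longleftrightarrow>
     (\<forall>X\<in>Obj C. omap F X \<in> Obj D) \<and>
     (\<forall>X\<in>Obj C. \<forall>Y\<in>Obj C. \<forall>f\<in>hom C X Y. amap F f \<in> hom D (omap F X) (omap F Y)) \<and>
     (\<forall>X\<in>Obj C. amap F (id\<^bsub>C\<^esub> X) = id\<^bsub>D\<^esub> (omap F X)) \<and>
     (\<forall>X\<in>Obj C. \<forall>Y\<in>Obj C. \<forall>Z\<in>Obj C. \<forall>f\<in>hom C X Y. \<forall>g\<in>hom C Y Z.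
        amap F (g \<cdot>\<^bsub>C\<^esub> f) = amap F g \<cdot>\<^bsub>D\<^esub> amap F f)"

definition id_functor :: "('o, 'a, 'o, 'a) functor_maps" where
  "id_functor = \<lparr>omap = (\<lambda>X. X), amap = (\<lambda>f. f)\<rparr>"

definition comp_functor ::
  "('p, 'b, 'q, 'c) functor_maps \<Rightarrow> ('o, 'a, 'p, 'b) functor_maps \<Rightarrow>
   ('o, 'a, 'q, 'c) functor_maps" where
  "comp_functor G F = \<lparr>omap = (\<lambda>X. omap G (omap F X)), amap = (\<lambda>f. amap G (amap F f))\<rparr>"

definition natural_transformation ::
  "('o, 'a, 'm) category_scheme \<Rightarrow> ('p, 'b, 'n) category_scheme \<Rightarrow>
   ('o, 'a, 'p, 'b) functor_maps \<Rightarrow> ('o, 'a, 'p, 'b) functor_maps \<Rightarrow> ('o \<Rightarrow> 'b) \<Rightarrow> bool" where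
  "natural_transformation C D F G \<tau> \<longleftrightarrow>
     (\<forall>X\<in>Obj C. \<tau> X \<in> hom D (omap F X) (omap G X)) \<and>
     (\<forall>X\<in>Obj C. \<forall>Y\<in>Obj C. \<forall>f\<in>hom C X Y. \<tau> Y \<cdot>\<^bsub>D\<^esub> amap F f = amap G f \<cdot>\<^bsub>D\<^esub> \<tau> X)"

definition natural_isomorphism ::
  "('o, 'a, 'm) category_scheme \<Rightarrow> ('p, 'b, 'n) category_scheme \<Rightarrow>
   ('o, 'a, 'p, 'b) functor_maps \<Rightarrow> ('o, 'a, 'p, 'b) functor_maps \<Rightarrow> ('o \<Rightarrow> 'b) \<Rightarrow> bool" where
  "natural_isomorphism C D F G \<tau> \<longleftrightarrow>
     natural_transformation C D F G \<tau> \<and> (\<forall>X\<in>Obj C. iso_arrow D (\<tau> X))"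

section \<open>Symmetric monoidal categories\<close>

record ('o, 'a) monoidal_category = "('o, 'a) category" +
  tensor :: "('o \<times> 'o, 'a \<times> 'a, 'o, 'a) functor_maps"
  tunit :: "'o" (\<open>\<one>\<index>\<close>)
  associator :: "'o \<Rightarrow> 'o \<Rightarrow> 'o \<Rightarrow> 'a"
  lunitor :: "'o \<Rightarrow> 'a"
  runitor :: "'o \<Rightarrow> 'a"

definition tensor_obj ::
  "('o, 'a, 'm) monoidal_category_scheme \<Rightarrow> 'o \<Rightarrow> 'o \<Rightarrow> 'o" (infixr \<open>\<odot>\<index>\<close> 70) where
  "X \<odot>\<^bsub>C\<^esub> Y = omap (tensor C) (X, Y)"

definition tensor_arr ::
  "('o, 'a, 'm) monoidal_category_scheme \<Rightarrow> 'a \<Rightarrow> 'a \<Rightarrow> 'a" (infixr \<open>\<otimes>\<index>\<close> 70) where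
  "f \<otimes>\<^bsub>C\<^esub> g = amap (tensor C) (f, g)"

locale monoidal_category = category C for C (structure) +
  assumes tensor_functor: "is_functor (prod_cat C C) C (tensor C)"
    and tunit_Obj: "\<one> \<in> Obj C"
    \<comment> \<open>\<open>associator C X Y Z\<close> goes from \<open>(X \<odot> Y) \<odot> Z\<close> to \<open>X \<odot> (Y \<odot> Z)\<close>\<close>
    and associator_natural:
      "natural_isomorphism (prod_cat (prod_cat C C) C) C
         \<lparr>omap = (\<lambda>((X, Y), Z). (X \<odot> Y) \<odot> Z), amap = (\<lambda>((f, g), h). (f \<otimes> g) \<otimes> h)\<rparr>
         \<lparr>omap = (\<lambda>((X, Y), Z). X \<odot> (Y \<odot> Z)), amap = (\<lambda>((f, g), h). f \<otimes> (g \<otimes> h))\<rparr>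
         (\<lambda>((X, Y), Z). associator C X Y Z)"
    and lunitor_natural:
      "natural_isomorphism C C
         \<lparr>omap = (\<lambda>X. \<one> \<odot> X), amap = (\<lambda>f. id \<one> \<otimes> f)\<rparr> id_functor (lunitor C)"
    and runitor_natural:
      "natural_isomorphism C C
         \<lparr>omap = (\<lambda>X. X \<odot> \<one>), amap = (\<lambda>f. f \<otimes> id \<one>)\<rparr> id_functor (runitor C)"
    and pentagon:
      "\<lbrakk>W \<in> Obj C; X \<in> Obj C; Y \<in> Obj C; Z \<in> Obj C\<rbrakk> \<Longrightarrow>
         associator C W X (Y \<odot> Z) \<cdot> associator C (W \<odot> X) Y Z =
         (id W \<otimes> associator C X Y Z) \<cdot> associator C W (X \<odot> Y) Z \<cdot> (associator C W X Y \<otimes> id Z)"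
    and triangle:
      "\<lbrakk>X \<in> Obj C; Y \<in> Obj C\<rbrakk> \<Longrightarrow>
         (id X \<otimes> lunitor C Y) \<cdot> associator C X \<one> Y = runitor C X \<otimes> id Y"

record ('o, 'a) symmetric_monoidal_category = "('o, 'a) monoidal_category" +
  braiding :: "'o \<Rightarrow> 'o \<Rightarrow> 'a"

locale symmetric_monoidal_category = monoidal_category C for C (structure) +
  assumes braiding_natural:
      "natural_isomorphism (prod_cat C C) C (tensor C)
         \<lparr>omap = (\<lambda>(X, Y). Y \<odot> X), amap = (\<lambda>(f, g). g \<otimes> f)\<rparr>
         (\<lambda>(X, Y). braiding C X Y)"
    and braiding_symmetric:
      "\<lbrakk>X \<in> Obj C; Y \<in> Obj C\<rbrakk> \<Longrightarrow> braiding C Y X \<cdot> braiding C X Y = id (X \<odot> Y)"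
    and hexagon:
      "\<lbrakk>X \<in> Obj C; Y \<in> Obj C; Z \<in> Obj C\<rbrakk> \<Longrightarrow>
         associator C Y Z X \<cdot> braiding C X (Y \<odot> Z) \<cdot> associator C X Y Z =
         (id Y \<otimes> braiding C X Z) \<cdot> associator C Y X Z \<cdot> (braiding C X Y \<otimes> id Z)"

section \<open>Strong monads\<close>

locale monad = category C for C (structure) +
  fixes T and \<eta> and \<mu>
  assumes T_functor: "is_functor C C T"
    and \<eta>_natural: "natural_transformation C C id_functor T \<eta>"
    and \<mu>_natural: "natural_transformation C C (comp_functor T T) T \<mu>"
    and \<mu>_\<eta>: "X \<in> Obj C \<Longrightarrow> \<mu> X \<cdot> \<eta> (omap T X) = id (omap T X)"
    and \<mu>_T\<eta>: "X \<in> Obj C \<Longrightarrow> \<mu> X \<cdot> amap T (\<eta> X) = id (omap T X)"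
    and \<mu>_\<mu>: "X \<in> Obj C \<Longrightarrow> \<mu> X \<cdot> \<mu> (omap T X) = \<mu> X \<cdot> amap T (\<mu> X)"

locale strong_monad = monoidal_category C + monad C T \<eta> \<mu>
  for C (structure) and T and \<eta> and \<mu> +
  fixes st
  assumes st_natural:
      "natural_transformation (prod_cat C C) C
         \<lparr>omap = (\<lambda>(X, Y). X \<odot> omap T Y), amap = (\<lambda>(f, g). f \<otimes> amap T g)\<rparr>
         (comp_functor T (tensor C))
         (\<lambda>(X, Y). st X Y)"
    and st_lunitor:
      "Y \<in> Obj C \<Longrightarrow> amap T (lunitor C Y) \<cdot> st \<one> Y = lunitor C (omap T Y)"
    and st_associator:
      "\<lbrakk>X \<in> Obj C; Y \<in> Obj C; Z \<in> Obj C\<rbrakk> \<Longrightarrow>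
         amap T (associator C X Y Z) \<cdot> st (X \<odot> Y) Z =
         st X (Y \<odot> Z) \<cdot> (id X \<otimes> st Y Z) \<cdot> associator C X Y (omap T Z)"
    and st_\<eta>:
      "\<lbrakk>X \<in> Obj C; Y \<in> Obj C\<rbrakk> \<Longrightarrow> st X Y \<cdot> (id X \<otimes> \<eta> Y) = \<eta> (X \<odot> Y)"
    and st_\<mu>:
      "\<lbrakk>X \<in> Obj C; Y \<in> Obj C\<rbrakk> \<Longrightarrow>
         st X Y \<cdot> (id X \<otimes> \<mu> Y) = \<mu> (X \<odot> Y) \<cdot> amap T (st X Y) \<cdot> st X (omap T Y)"

end

theory Submission
  imports Defs
begin

text \<open>
  The formula for the strength is forced by two of its laws. A product point
  \<open>(x \<otimes> \<xi>) \<cdot> \<lambda>\<^sub>I\<inverse>\<close> splits as \<open>(x \<otimes> id) \<cdot> (id \<otimes> \<xi>) \<cdot> \<lambda>\<^sub>I\<inverse>\<close>. Naturality of the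
  strength in its first argument moves \<open>x \<otimes> id\<close> across it and leaves the component at the
  unit object. There the unitor law identifies \<open>st\<^bsub>I,Y\<^esub>\<close> with \<open>T \<lambda>\<^sub>Y\<inverse> \<cdot> \<lambda>\<^bsub>TY\<^esub>\<close>,
  and naturality of \<open>\<lambda>\<close> at \<open>\<xi>\<close> cancels the remaining unitors
  (\<open>strength_at_product_point\<close>).

  Conversely, the formula prescribes the values of an arrow on all product points of
  \<open>X \<odot> TY\<close>. When every point of a tensor product is a product point and the unit object is
  a separator, these values determine the arrow (\<open>arrow_eq_if_eq_on_product_points\<close>).
\<close>

context category
begin

lemma inverse_arrows_unique:
  assumes "inverse_arrows C f g" and "inverse_arrows C f h"
  shows "g = h"
proof -
  let ?X = "Dom C f" and ?Y = "Cod C f"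
  have f: "f \<in> hom C ?X ?Y" and g: "g \<in> hom C ?Y ?X" and h: "h \<in> hom C ?Y ?X"
    and gf: "g \<cdot> f = id ?X" and fh: "f \<cdot> h = id ?Y"
    using assms by (auto simp: inverse_arrows_def hom_def)
  have "g = g \<cdot> (f \<cdot> h)"
    using Comp_ide[OF g] fh by simp
  also have "\<dots> = (g \<cdot> f) \<cdot> h"
    using Comp_assoc[OF h f g] by simp
  also have "\<dots> = h"
    using ide_Comp[OF h] gf by simp
  finally show ?thesis .
qed

lemma inv_arrow_inverse:
  assumes "iso_arrow C f" and f: "f \<in> hom C X Y"
  shows "inv_arrow C f \<in> hom C Y X"
    and "inv_arrow C f \<cdot> f = id X"
    and "f \<cdot> inv_arrow C f = id Y"
proof -
  have "inverse_arrows C f (inv_arrow C f)"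
    unfolding inv_arrow_def
    using assms(1) inverse_arrows_unique by (auto simp: iso_arrow_def intro: theI)
  then show "inv_arrow C f \<in> hom C Y X" "inv_arrow C f \<cdot> f = id X" "f \<cdot> inv_arrow C f = id Y"
    using f by (auto simp: inverse_arrows_def hom_def)
qed

end

context monoidal_category
begin

lemma tensor_arr_hom:
  assumes "X \<in> Obj C" "X' \<in> Obj C" "Y \<in> Obj C" "Y' \<in> Obj C"
    and "f \<in> hom C X X'" "g \<in> hom C Y Y'"
  shows "f \<otimes> g \<in> hom C (X \<odot> Y) (X' \<odot> Y')"
proof -
  have "(f, g) \<in> hom (prod_cat C C) (X, Y) (X', Y')"
    using assms by (auto simp: hom_def prod_cat_def)
  moreover have "(X, Y) \<in> Obj (prod_cat C C)" "(X', Y') \<in> Obj (prod_cat C C)"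
    using assms by (auto simp: prod_cat_def)
  ultimately show ?thesis
    using tensor_functor unfolding is_functor_def tensor_arr_def tensor_obj_def by blast
qed

lemma tensor_obj_Obj: "\<lbrakk>X \<in> Obj C; Y \<in> Obj C\<rbrakk> \<Longrightarrow> X \<odot> Y \<in> Obj C"
  using tensor_functor by (auto simp: is_functor_def tensor_obj_def prod_cat_def)

lemma tensor_arr_Comp:
  assumes obj: "X \<in> Obj C" "X' \<in> Obj C" "X'' \<in> Obj C" "Y \<in> Obj C" "Y' \<in> Obj C" "Y'' \<in> Obj C"
    and arr: "f \<in> hom C X X'" "f' \<in> hom C X' X''" "g \<in> hom C Y Y'" "g' \<in> hom C Y' Y''"
  shows "(f' \<cdot> f) \<otimes> (g' \<cdot> g) = (f' \<otimes> g') \<cdot> (f \<otimes> g)"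
proof -
  have "(f, g) \<in> hom (prod_cat C C) (X, Y) (X', Y')"
    "(f', g') \<in> hom (prod_cat C C) (X', Y') (X'', Y'')"
    using arr by (auto simp: hom_def prod_cat_def)
  moreover have "(X, Y) \<in> Obj (prod_cat C C)" "(X', Y') \<in> Obj (prod_cat C C)"
    "(X'', Y'') \<in> Obj (prod_cat C C)"
    using obj by (auto simp: prod_cat_def)
  ultimately have "amap (tensor C) ((f', g') \<cdot>\<^bsub>prod_cat C C\<^esub> (f, g)) =
      amap (tensor C) (f', g') \<cdot> amap (tensor C) (f, g)"
    using tensor_functor unfolding is_functor_def by blast
  then show ?thesis
    by (simp add: tensor_arr_def prod_cat_def)
qed

lemma lunitor_hom: "X \<in> Obj C \<Longrightarrow> lunitor C X \<in> hom C (\<one> \<odot> X) X"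
  using lunitor_natural
  by (auto simp: natural_isomorphism_def natural_transformation_def id_functor_def)

lemma lunitor_iso: "X \<in> Obj C \<Longrightarrow> iso_arrow C (lunitor C X)"
  using lunitor_natural by (auto simp: natural_isomorphism_def)

lemma lunitor_naturality:
  "\<lbrakk>X \<in> Obj C; Y \<in> Obj C; f \<in> hom C X Y\<rbrakk> \<Longrightarrow> lunitor C Y \<cdot> (id \<one> \<otimes> f) = f \<cdot> lunitor C X"
  using lunitor_natural
  by (auto simp: natural_isomorphism_def natural_transformation_def id_functor_def)

lemmas lunitor_inverse = inv_arrow_inverse[OF lunitor_iso lunitor_hom]

text \<open>
  The factorization hypothesis makes a test on product points a test on all points of
  \<open>X \<odot> Y\<close>, and such a test detects equality because the unit object separates arrows.
\<close>

lemma arrow_eq_if_eq_on_product_points: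
  assumes "separator C \<one>"
    and product_points: "\<And>z. z \<in> hom C \<one> (X \<odot> Y) \<Longrightarrow>
      \<exists>x\<in>hom C \<one> X. \<exists>y\<in>hom C \<one> Y. z = (x \<otimes> y) \<cdot> inv_arrow C (lunitor C \<one>)"
    and obj: "X \<in> Obj C" "Y \<in> Obj C" "Z \<in> Obj C"
    and arr: "f \<in> hom C (X \<odot> Y) Z" "g \<in> hom C (X \<odot> Y) Z"
    and agree: "\<And>x y. \<lbrakk>x \<in> hom C \<one> X; y \<in> hom C \<one> Y\<rbrakk> \<Longrightarrow>
      f \<cdot> (x \<otimes> y) \<cdot> inv_arrow C (lunitor C \<one>) = g \<cdot> (x \<otimes> y) \<cdot> inv_arrow C (lunitor C \<one>)"
  shows "f = g"
proof -
  have "f \<cdot> z = g \<cdot> z" if "z \<in> hom C \<one> (X \<odot> Y)" for z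
    using product_points[OF that] agree by auto
  then show ?thesis
    using assms(1) tensor_obj_Obj[OF obj(1,2)] obj(3) arr unfolding separator_def by blast
qed

end

context strong_monad
begin

lemma T_Obj: "X \<in> Obj C \<Longrightarrow> omap T X \<in> Obj C"
  using T_functor by (auto simp: is_functor_def)

lemma T_hom: "\<lbrakk>X \<in> Obj C; Y \<in> Obj C; f \<in> hom C X Y\<rbrakk> \<Longrightarrow> amap T f \<in> hom C (omap T X) (omap T Y)"
  using T_functor by (auto simp: is_functor_def)

lemma T_ide: "X \<in> Obj C \<Longrightarrow> amap T (id X) = id (omap T X)"
  using T_functor by (auto simp: is_functor_def)

lemma T_Comp:
  "\<lbrakk>X \<in> Obj C; Y \<in> Obj C; Z \<in> Obj C; f \<in> hom C X Y; g \<in> hom C Y Z\<rbrakk> \<Longrightarrow>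
     amap T (g \<cdot> f) = amap T g \<cdot> amap T f"
  using T_functor by (auto simp: is_functor_def)

lemma st_hom:
  assumes "X \<in> Obj C" "Y \<in> Obj C"
  shows "st X Y \<in> hom C (X \<odot> omap T Y) (omap T (X \<odot> Y))"
  using st_natural assms
  by (auto simp: natural_transformation_def prod_cat_def comp_functor_def tensor_obj_def)

lemma st_naturality_left:
  assumes X: "X \<in> Obj C" and X': "X' \<in> Obj C" and Y: "Y \<in> Obj C" and f: "f \<in> hom C X X'"
  shows "st X' Y \<cdot> (f \<otimes> id (omap T Y)) = amap T (f \<otimes> id Y) \<cdot> st X Y"
proof -
  have "(f, id Y) \<in> hom (prod_cat C C) (X, Y) (X', Y)"
    using f ide_hom[OF Y] by (auto simp: hom_def prod_cat_def)
  moreover have "(X, Y) \<in> Obj (prod_cat C C)" "(X', Y) \<in> Obj (prod_cat C C)"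
    using X X' Y by (auto simp: prod_cat_def)
  ultimately have "st X' Y \<cdot> (f \<otimes> amap T (id Y)) = amap T (f \<otimes> id Y) \<cdot> st X Y"
    using st_natural unfolding natural_transformation_def
    by (fastforce simp: comp_functor_def tensor_arr_def)
  then show ?thesis
    using T_ide[OF Y] by simp
qed

text \<open>
  The unitor law leaves no freedom at the unit object: since \<open>T \<lambda>\<^sub>Y\<close> is invertible, it can be
  solved for the strength.
\<close>

lemma st_unit_lunitor_inverse:
  assumes Y: "Y \<in> Obj C"
  shows "st \<one> Y \<cdot> inv_arrow C (lunitor C (omap T Y)) = amap T (inv_arrow C (lunitor C Y))"
proof -
  let ?l = "lunitor C Y" and ?k = "lunitor C (omap T Y)"
  let ?l' = "inv_arrow C ?l" and ?k' = "inv_arrow C ?k"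
  note IY = tensor_obj_Obj[OF tunit_Obj Y] and TY = T_Obj[OF Y]
  note l = lunitor_hom[OF Y] and l' = lunitor_inverse[OF Y Y]
  note k' = lunitor_inverse[OF TY TY]
  note st = st_hom[OF tunit_Obj Y]
  note Tl = T_hom[OF IY Y l] and Tl' = T_hom[OF Y IY l'(1)]
  have "st \<one> Y = amap T (?l' \<cdot> ?l) \<cdot> st \<one> Y"
    using l'(2) T_ide[OF IY] ide_Comp[OF st] by simp
  also have "\<dots> = amap T ?l' \<cdot> amap T ?l \<cdot> st \<one> Y"
    using T_Comp[OF IY Y IY l l'(1)] Comp_assoc[OF st Tl Tl'] by simp
  also have "\<dots> = amap T ?l' \<cdot> ?k"
    using st_lunitor[OF Y] by simp
  finally have "st \<one> Y \<cdot> ?k' = amap T ?l' \<cdot> ?k \<cdot> ?k'"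
    using Comp_assoc[OF k'(1) lunitor_hom[OF TY] Tl'] by simp
  then show ?thesis
    using k'(3) Comp_ide[OF Tl'] by simp
qed

lemma strength_at_product_point:
  assumes X: "X \<in> Obj C" and Y: "Y \<in> Obj C"
    and x: "x \<in> hom C \<one> X" and \<xi>: "\<xi> \<in> hom C \<one> (omap T Y)"
  shows "st X Y \<cdot> (x \<otimes> \<xi>) \<cdot> inv_arrow C (lunitor C \<one>) =
    amap T ((x \<otimes> id Y) \<cdot> inv_arrow C (lunitor C Y)) \<cdot> \<xi>"
proof -
  let ?i' = "inv_arrow C (lunitor C \<one>)" and ?l' = "inv_arrow C (lunitor C Y)"
  let ?k = "lunitor C (omap T Y)" let ?k' = "inv_arrow C ?k"
  note I = tunit_Obj and TY = T_Obj[OF Y]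
  note XY = tensor_obj_Obj[OF X Y] and IY = tensor_obj_Obj[OF I Y]
  note i' = lunitor_inverse[OF I I] and l' = lunitor_inverse[OF Y Y] and k' = lunitor_inverse[OF TY TY]
  note id_I = ide_hom[OF I] and id_Y = ide_hom[OF Y] and id_TY = ide_hom[OF TY]
  note st_X = st_hom[OF X Y] and st_I = st_hom[OF I Y]
  note xY = tensor_arr_hom[OF I X Y Y x id_Y] and xTY = tensor_arr_hom[OF I X TY TY x id_TY]
  note I\<xi> = tensor_arr_hom[OF I I I TY id_I \<xi>]
  note TxY = T_hom[OF IY XY xY] and Tl' = T_hom[OF Y IY l'(1)]
  note I\<xi>i' = Comp_hom[OF i'(1) I\<xi>]
  have split: "x \<otimes> \<xi> = (x \<otimes> id (omap T Y)) \<cdot> (id \<one> \<otimes> \<xi>)"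
    using tensor_arr_Comp[OF I I X I TY TY id_I x \<xi> id_TY] Comp_ide[OF x] ide_Comp[OF \<xi>] by simp
  \<comment> \<open>Naturality of \<open>\<lambda>\<close> at \<open>\<xi>\<close>, conjugated by the inverses of both components.\<close>
  have slide: "(id \<one> \<otimes> \<xi>) \<cdot> ?i' = ?k' \<cdot> \<xi>"
  proof -
    have "(id \<one> \<otimes> \<xi>) \<cdot> ?i' = (?k' \<cdot> ?k) \<cdot> (id \<one> \<otimes> \<xi>) \<cdot> ?i'"
      using k'(2) ide_Comp[OF I\<xi>i'] by simp
    also have "\<dots> = ?k' \<cdot> ?k \<cdot> (id \<one> \<otimes> \<xi>) \<cdot> ?i'"
      using Comp_assoc[OF I\<xi>i' lunitor_hom[OF TY] k'(1)] .
    also have "\<dots> = ?k' \<cdot> (?k \<cdot> (id \<one> \<otimes> \<xi>)) \<cdot> ?i'"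
      using Comp_assoc[OF i'(1) I\<xi> lunitor_hom[OF TY]] by simp
    also have "\<dots> = ?k' \<cdot> \<xi> \<cdot> lunitor C \<one> \<cdot> ?i'"
      using lunitor_naturality[OF I TY \<xi>] Comp_assoc[OF i'(1) lunitor_hom[OF I] \<xi>] by simp
    finally show ?thesis
      using i'(3) Comp_ide[OF \<xi>] by simp
  qed
  have "st X Y \<cdot> (x \<otimes> \<xi>) \<cdot> ?i' = st X Y \<cdot> (x \<otimes> id (omap T Y)) \<cdot> (id \<one> \<otimes> \<xi>) \<cdot> ?i'"
    using split Comp_assoc[OF i'(1) I\<xi> xTY] by simp
  also have "\<dots> = (st X Y \<cdot> (x \<otimes> id (omap T Y))) \<cdot> ?k' \<cdot> \<xi>"
    using Comp_assoc[OF I\<xi>i' xTY st_X] slide by simp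
  also have "\<dots> = amap T (x \<otimes> id Y) \<cdot> st \<one> Y \<cdot> ?k' \<cdot> \<xi>"
    using st_naturality_left[OF I X Y x] Comp_assoc[OF Comp_hom[OF \<xi> k'(1)] st_I TxY] by simp
  also have "\<dots> = amap T (x \<otimes> id Y) \<cdot> amap T ?l' \<cdot> \<xi>"
    using st_unit_lunitor_inverse[OF Y] Comp_assoc[OF \<xi> k'(1) st_I] by simp
  also have "\<dots> = amap T ((x \<otimes> id Y) \<cdot> ?l') \<cdot> \<xi>"
    using T_Comp[OF Y IY XY l'(1) xY] Comp_assoc[OF \<xi> Tl' TxY] by simp
  finally show ?thesis .
qed

end

theorem lemma2:
  fixes C :: "('o, 'a, 'm) symmetric_monoidal_category_scheme" (structure)
    and T :: "('o, 'a, 'o, 'a) functor_maps"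
    and \<eta> \<mu> :: "'o \<Rightarrow> 'a"
    and st :: "'o \<Rightarrow> 'o \<Rightarrow> 'a"
  assumes "symmetric_monoidal_category C"
    and "separator C \<one>"
    and "\<And>X Y z. \<lbrakk>X \<in> Obj C; Y \<in> Obj C; z \<in> hom C \<one> (X \<odot> Y)\<rbrakk> \<Longrightarrow>
           \<exists>x\<in>hom C \<one> X. \<exists>y\<in>hom C \<one> Y. z = (x \<otimes> y) \<cdot> inv_arrow C (lunitor C \<one>)"
    and "strong_monad C T \<eta> \<mu> st"
  shows "(\<forall>X\<in>Obj C. \<forall>Y\<in>Obj C. \<forall>x\<in>hom C \<one> X. \<forall>\<xi>\<in>hom C \<one> (omap T Y).
            st X Y \<cdot> (x \<otimes> \<xi>) \<cdot> inv_arrow C (lunitor C \<one>) =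
            amap T ((x \<otimes> id Y) \<cdot> inv_arrow C (lunitor C Y)) \<cdot> \<xi>) \<and>
         (\<forall>X\<in>Obj C. \<forall>Y\<in>Obj C. \<forall>s\<in>hom C (X \<odot> omap T Y) (omap T (X \<odot> Y)).
            (\<forall>x\<in>hom C \<one> X. \<forall>\<xi>\<in>hom C \<one> (omap T Y).
               s \<cdot> (x \<otimes> \<xi>) \<cdot> inv_arrow C (lunitor C \<one>) =
               amap T ((x \<otimes> id Y) \<cdot> inv_arrow C (lunitor C Y)) \<cdot> \<xi>) \<longrightarrow>
            s = st X Y)"
proof -
  interpret symmetric_monoidal_category C by fact
  interpret strong_monad C T \<eta> \<mu> st by fact
  note formula = strength_at_product_point
  have "s = st X Y"
    if XY: "X \<in> Obj C" "Y \<in> Obj C" and s: "s \<in> hom C (X \<odot> omap T Y) (omap T (X \<odot> Y))"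
      and s_formula: "\<forall>x\<in>hom C \<one> X. \<forall>\<xi>\<in>hom C \<one> (omap T Y).
        s \<cdot> (x \<otimes> \<xi>) \<cdot> inv_arrow C (lunitor C \<one>) =
        amap T ((x \<otimes> id Y) \<cdot> inv_arrow C (lunitor C Y)) \<cdot> \<xi>" for X Y s
  proof (rule arrow_eq_if_eq_on_product_points[OF assms(2)])
    fix x \<xi>
    assume "x \<in> hom C \<one> X" "\<xi> \<in> hom C \<one> (omap T Y)"
    then show "s \<cdot> (x \<otimes> \<xi>) \<cdot> inv_arrow C (lunitor C \<one>) =
        st X Y \<cdot> (x \<otimes> \<xi>) \<cdot> inv_arrow C (lunitor C \<one>)"
      using s_formula formula[OF XY] by simp
  qed (use XY s assms(3) T_Obj tensor_obj_Obj st_hom in auto)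
  with formula show ?thesis by blast
qed

end
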